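(* Let $I=(0,\infty)$, $f:I\to\mathbb{R}$, let $X_0\subset\mathbb{R}$ be an interval of positive length, and let $p\ge3$ be an integer. Suppose that for every kernel $H:X_0\times X_0\to\mathbb{R}$ of the form $H(x,y) = c_1u_1^{x+y} + c_2u_2^{x+y}$ with $u_1,u_2>0$, $c_1,c_2\ge0$, $c_1+c_2>0$, the kernel $f\circ H$ is $\mathrm{TN}_p$ on $X_0\times X_0$. Then $f\in C^{p-3}(I)$, $f^{(p-3)}$ is convex on $I$, and $f,f',\dots,f^{(p-3)}\ge0$ on $I$. If moreover $f\in C^{p-1}(I)$, then also $f^{(p-2)},f^{(p-1)}\ge0$ on $I$.
   Context: For $X \subset \mathbb{R}$, a kernel $K : X \times X \to \mathbb{R}$ is $\mathrm{TN}_p$ if $\det (K(x_j,y_k))_{j,k=1}^r \geq 0$ for all $1 \leq r \leq p$ and all real $x_1<\dots<x_r$, $y_1<\dots<y_r$ in $X$. *)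

theory Defs
  imports "HOL-Analysis.Analysis"
begin

definition ldet :: "nat \<Rightarrow> (nat \<Rightarrow> nat \<Rightarrow> real) \<Rightarrow> real" where
  "ldet r M = (\<Sum>\<sigma> | \<sigma> permutes {..<r}. of_int (sign \<sigma>) * (\<Prod>i<r. M i (\<sigma> i)))"

definition TN :: "nat \<Rightarrow> real set \<Rightarrow> (real \<Rightarrow> real \<Rightarrow> real) \<Rightarrow> bool" where
  "TN p X K \<longleftrightarrow> (\<forall>r. 1 \<le> r \<and> r \<le> p \<longrightarrow>
     (\<forall>x y :: nat \<Rightarrow> real.
        (\<forall>i<r. x i \<in> X \<and> y i \<in> X) \<and>
        (\<forall>i. Suc i < r \<longrightarrow> x i < x (Suc i) \<and> y i < y (Suc i))
        \<longrightarrow> ldet r (\<lambda>i j. K (x i) (y j)) \<ge> 0))"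

definition Ck_on :: "nat \<Rightarrow> (real \<Rightarrow> real) \<Rightarrow> real set \<Rightarrow> bool" where
  "Ck_on k f S \<longleftrightarrow> (\<forall>j<k. \<forall>x\<in>S. (deriv ^^ j) f differentiable (at x))
                     \<and> continuous_on S ((deriv ^^ k) f)"

end

theory Submission
  imports Defs "Jordan_Normal_Form.Determinant"
begin

text \<open>Along an arithmetic progression in \<open>X\<^sub>0\<close> the kernels become the Hankel matrices
  with entries \<open>c\<^sub>1 q\<^sub>1 ^ (i + j) + c\<^sub>2 q\<^sub>2 ^ (i + j)\<close>. Symmetric matrices with nonnegative principal
  minors are positive semidefinite, so \<open>f\<close> applied to these entries gives a nonnegative quadratic
  form. The \<open>2 \<times> 2\<close> forms make \<open>f\<close> monotone and continuous. If \<open>f\<close> is smooth, a weight vector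
  orthogonal to all powers below \<open>n\<close> isolates the \<open>n\<close>-th Taylor coefficient in
  \<open>f (a + t 2 ^ (i + j))\<close> and shows that \<open>f^(n)(a)\<close> is nonnegative (Horn and Loewner). In general this is
  applied to the \<open>n\<close>-th difference of an \<open>n\<close>-fold antiderivative of \<open>f\<close>: it inherits the form
  condition, and its \<open>n\<close>-th derivative is the \<open>n\<close>-th difference of \<open>f\<close>. Nonnegative differences up to
  order \<open>p - 1\<close> force the regularity of \<open>f\<close> by induction, as the right derivative of \<open>f\<close> again has
  nonnegative differences, up to order \<open>p - 2\<close>.\<close>

section \<open>Principal minors and positive semidefiniteness\<close>

text \<open>Links the Leibniz sum to \<open>det\<close>, so that multiplicativity and Laplace
  expansion can be applied to it.\<close>

lemma ldet_eq_det: "ldet r M = det (mat r r (\<lambda>(i, j). M i j))"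
proof -
  have "(\<Prod>i<r. M i (\<sigma> i)) = (\<Prod>i = 0..<r. mat r r (\<lambda>(i, j). M i j) $$ (i, \<sigma> i))"
    if "\<sigma> permutes {..<r}" for \<sigma>
  proof (rule prod.cong)
    fix i assume "i \<in> {0..<r}"
    then show "M i (\<sigma> i) = mat r r (\<lambda>(i, j). M i j) $$ (i, \<sigma> i)"
      using permutes_in_image[OF that, of i] by auto
  qed auto
  then show ?thesis
    unfolding ldet_def det_def by (auto simp: lessThan_atLeast0 intro!: sum.cong)
qed

text \<open>One step of Gaussian elimination: the matrix is \<open>L * U\<close> with
  \<open>L\<close> unit lower triangular, and \<open>U\<close> has zeros below the pivot
  \<open>M 0 0\<close> and the Schur complement in the remaining block.\<close>

lemma ldet_schur:
  assumes "M 0 0 \<noteq> 0"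
  shows "ldet (Suc r) M
    = M 0 0 * ldet r (\<lambda>i j. M (Suc i) (Suc j) - M (Suc i) 0 * M 0 (Suc j) / M 0 0)"
proof -
  define A where "A = mat (Suc r) (Suc r) (\<lambda>(i, j). M i j)"
  define L where "L = mat (Suc r) (Suc r)
    (\<lambda>(i, j). if i = j then 1 else if j = 0 then M i 0 / M 0 0 else 0)"
  define S where "S = (\<lambda>i j. M (Suc i) (Suc j) - M (Suc i) 0 * M 0 (Suc j) / M 0 0)"
  define U where "U = mat (Suc r) (Suc r)
    (\<lambda>(i, j). if i = 0 then M 0 j else if j = 0 then 0 else S (i - 1) (j - 1))"
  have carr: "A \<in> carrier_mat (Suc r) (Suc r)" "L \<in> carrier_mat (Suc r) (Suc r)"
    "U \<in> carrier_mat (Suc r) (Suc r)"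
    by (simp_all add: A_def L_def U_def)
  have "A = L * U"
  proof (rule eq_matI)
    fix i j assume "i < dim_row (L * U)" "j < dim_col (L * U)"
    then have ij: "i < Suc r" "j < Suc r" by (simp_all add: L_def U_def)
    have "(L * U) $$ (i, j) = (\<Sum>k = 0..<Suc r. L $$ (i, k) * U $$ (k, j))"
      using ij carr by (simp add: scalar_prod_def)
    also have "\<dots> = L $$ (i, 0) * U $$ (0, j) + (\<Sum>k = 1..<Suc r. L $$ (i, k) * U $$ (k, j))"
      by (subst sum.atLeast_Suc_lessThan) auto
    also have "(\<Sum>k = 1..<Suc r. L $$ (i, k) * U $$ (k, j))
      = (\<Sum>k = 1..<Suc r. if k = i then U $$ (i, j) else 0)"
      using ij by (intro sum.cong) (auto simp: L_def)
    also have "L $$ (i, 0) * U $$ (0, j) + \<dots> = A $$ (i, j)"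
      using ij assms by (cases i; cases j) (auto simp: L_def U_def A_def S_def)
    finally show "A $$ (i, j) = (L * U) $$ (i, j)" by simp
  qed (simp_all add: A_def L_def U_def)
  then have "det A = det L * det U"
    using det_mult[OF carr(2,3)] by simp
  moreover have "det L = 1"
  proof -
    have "det L = prod_list (diag_mat L)"
      by (rule det_lower_triangular[OF _ carr(2)]) (auto simp: L_def)
    then show ?thesis
      by (simp add: prod_list_diag_prod L_def)
  qed
  moreover have "det U = M 0 0 * ldet r S"
  proof -
    have "det U = (\<Sum>i<Suc r. U $$ (i, 0) * cofactor U i 0)"
      by (rule laplace_expansion_column[OF carr(3)]) simp
    also have "\<dots> = U $$ (0, 0) * cofactor U 0 0"
      by (subst sum.lessThan_Suc_shift) (auto simp: U_def)
    also have "mat_delete U 0 0 = mat r r (\<lambda>(i, j). S i j)"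
      by (rule eq_matI) (auto simp: U_def mat_delete_def)
    then have "cofactor U 0 0 = ldet r S"
      by (simp add: cofactor_def ldet_eq_det)
    finally show ?thesis by (simp add: U_def)
  qed
  ultimately show ?thesis by (simp add: ldet_eq_det A_def S_def)
qed

lemma ldet_1: "ldet 1 M = M 0 0"
  by (simp add: ldet_eq_det det_single)

lemma ldet_2: "ldet 2 M = M 0 0 * M 1 1 - M 0 1 * M 1 0"
  by (simp add: ldet_eq_det laplace_expansion_row[of _ 2 0] cofactor_def mat_delete_def
      numeral_2_eq_2 det_single)

text \<open>Induction on \<open>n\<close>, eliminating index 0. If the pivot is zero, the 2 x 2
  minors force row and column 0 to vanish. If it is positive, every principal minor of the Schur
  complement is a principal minor of \<open>A\<close> through index 0 divided by the pivot, and
  completing the square reduces the form to that of the Schur complement.\<close>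

lemma psd_of_principal_minors:
  fixes A :: "nat \<Rightarrow> nat \<Rightarrow> real"
  assumes "\<And>i j. i < n \<Longrightarrow> j < n \<Longrightarrow> A i j = A j i"
    and "\<And>r s. 1 \<le> r \<Longrightarrow> strict_mono_on {..<r} s \<Longrightarrow> s ` {..<r} \<subseteq> {..<n}
      \<Longrightarrow> 0 \<le> ldet r (\<lambda>i j. A (s i) (s j))"
  shows "0 \<le> (\<Sum>i<n. \<Sum>j<n. c i * c j * A i j)"
  using assms
proof (induction n arbitrary: A c)
  case 0
  then show ?case by simp
next
  case (Suc n)
  note sym = Suc.prems(1) and minors = Suc.prems(2)
  define T where "T = (\<Sum>i<n. c (Suc i) * A (Suc i) 0)"
  have split: "(\<Sum>i<Suc n. \<Sum>j<Suc n. c i * c j * A i j)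
    = c 0 * c 0 * A 0 0 + 2 * c 0 * T
      + (\<Sum>i<n. \<Sum>j<n. c (Suc i) * c (Suc j) * A (Suc i) (Suc j))"
  proof -
    have "(\<Sum>j<n. c 0 * c (Suc j) * A 0 (Suc j)) = c 0 * T"
      unfolding T_def sum_distrib_left using sym by (intro sum.cong) auto
    moreover have "(\<Sum>i<n. c (Suc i) * c 0 * A (Suc i) 0) = c 0 * T"
      unfolding T_def sum_distrib_left by (intro sum.cong) auto
    ultimately show ?thesis
      by (simp add: sum.lessThan_Suc_shift sum.distrib del: sum.lessThan_Suc)
  qed
  have "0 \<le> ldet 1 (\<lambda>i j. A (id i) (id j))"
    by (rule minors) (auto simp: strict_mono_on_def)
  then have A00: "0 \<le> A 0 0" by (simp only: ldet_1 id_apply)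
  show ?case
  proof (cases "A 0 0 = 0")
    case True
    have row: "A (Suc i) 0 = 0" if "i < n" for i
    proof -
      \<comment> \<open>With a zero corner this minor is minus the square of the off-diagonal
        entry.\<close>
      have "0 \<le> ldet 2 (\<lambda>k l. A ((\<lambda>k. if k = 0 then 0 else Suc i) k) ((\<lambda>k. if k = 0 then 0 else Suc i) l))"
        by (rule minors) (use that in \<open>auto simp: strict_mono_on_def\<close>)
      then have "0 \<le> - (A (Suc i) 0 * A (Suc i) 0)"
        using True sym[of 0 "Suc i"] that by (simp add: ldet_2)
      then show ?thesis by (metis mult_eq_0_iff neg_0_le_iff_le zero_le_square order_antisym)
    qed
    have "0 \<le> (\<Sum>i<n. \<Sum>j<n. c (Suc i) * c (Suc j) * A (Suc i) (Suc j))"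
    proof (rule Suc.IH[of "\<lambda>i j. A (Suc i) (Suc j)" "\<lambda>i. c (Suc i)"])
      fix r :: nat and s :: "nat \<Rightarrow> nat"
      assume "1 \<le> r" "strict_mono_on {..<r} s" "s ` {..<r} \<subseteq> {..<n}"
      then show "0 \<le> ldet r (\<lambda>i j. A (Suc (s i)) (Suc (s j)))"
        by (intro minors[of r "\<lambda>i. Suc (s i)"]) (auto simp: strict_mono_on_def)
    qed (use sym in auto)
    moreover have "T = 0" using row by (simp add: T_def)
    ultimately show ?thesis using True unfolding split by simp
  next
    case False
    define S where "S = (\<lambda>i j. A (Suc i) (Suc j) - A (Suc i) 0 * A 0 (Suc j) / A 0 0)"
    have "0 \<le> (\<Sum>i<n. \<Sum>j<n. c (Suc i) * c (Suc j) * S i j)"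
    proof (rule Suc.IH)
      show "S i j = S j i" if "i < n" "j < n" for i j
        using that sym[of "Suc i" "Suc j"] sym[of 0 "Suc i"] sym[of 0 "Suc j"]
        by (simp add: S_def)
    next
      fix r :: nat and s :: "nat \<Rightarrow> nat"
      assume rs: "1 \<le> r" "strict_mono_on {..<r} s" "s ` {..<r} \<subseteq> {..<n}"
      \<comment> \<open>Prepending index 0 to the selection makes \<open>ldet_schur\<close> relate
        the minor of \<open>A\<close> to that of \<open>S\<close>.\<close>
      define s' where "s' = case_nat 0 (\<lambda>i. Suc (s i))"
      have "0 \<le> ldet (Suc r) (\<lambda>i j. A (s' i) (s' j))"
      proof (rule minors)
        show "strict_mono_on {..<Suc r} s'"
          using rs(2) by (auto simp: strict_mono_on_def s'_def split: nat.splits)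
        show "s' ` {..<Suc r} \<subseteq> {..<Suc n}"
          using rs(3) by (auto simp: s'_def image_subset_iff split: nat.splits)
      qed simp
      also have "\<dots> = A 0 0 * ldet r (\<lambda>i j. S (s i) (s j))"
        using False by (subst ldet_schur) (auto simp: s'_def S_def)
      finally show "0 \<le> ldet r (\<lambda>i j. S (s i) (s j))"
        using A00 False by (simp add: zero_le_mult_iff)
    qed
    also have "(\<Sum>i<n. \<Sum>j<n. c (Suc i) * c (Suc j) * S i j)
      = (\<Sum>i<n. \<Sum>j<n. c (Suc i) * c (Suc j) * A (Suc i) (Suc j)) - T * T / A 0 0"
    proof -
      have "T * T / A 0 0
        = (\<Sum>i<n. \<Sum>j<n. (c (Suc i) * A (Suc i) 0) * (c (Suc j) * A (Suc j) 0)) / A 0 0"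
        unfolding T_def by (simp add: sum_product)
      also have "\<dots> = (\<Sum>i<n. \<Sum>j<n. c (Suc i) * c (Suc j) * (A (Suc i) 0 * A 0 (Suc j) / A 0 0))"
        unfolding sum_divide_distrib using sym by (intro sum.cong) auto
      finally show ?thesis
        by (simp add: S_def right_diff_distrib sum_subtractf)
    qed
    finally have *: "T * T / A 0 0
      \<le> (\<Sum>i<n. \<Sum>j<n. c (Suc i) * c (Suc j) * A (Suc i) (Suc j))" by simp
    \<comment> \<open>The terms containing \<open>c 0\<close>, together with the correction split
      off from the Schur form, are a perfect square.\<close>
    have "c 0 * c 0 * A 0 0 + 2 * c 0 * T + T * T / A 0 0 = A 0 0 * (c 0 + T / A 0 0)\<^sup>2"
      using False by (simp add: power2_eq_square field_simps)
    also have "\<dots> \<ge> 0" using A00 by simp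
    finally show ?thesis using * unfolding split by simp
  qed
qed

section \<open>Finite differences and regularity\<close>

definition fdiff :: "real \<Rightarrow> (real \<Rightarrow> real) \<Rightarrow> real \<Rightarrow> real" where
  "fdiff d f x = f (x + d) - f x"

lemma funpow_fdiff_Suc: "(fdiff d ^^ Suc k) f x = (fdiff d ^^ k) f (x + d) - (fdiff d ^^ k) f x"
  by (simp add: fdiff_def)

lemma funpow_fdiff_commute:
  "(fdiff d ^^ k) (fdiff e f) x = fdiff e ((fdiff d ^^ k) f) x"
proof (induction k arbitrary: x)
  case (Suc k)
  have "(fdiff d ^^ Suc k) (fdiff e f) x
    = fdiff e ((fdiff d ^^ k) f) (x + d) - fdiff e ((fdiff d ^^ k) f) x"
    unfolding funpow_fdiff_Suc Suc ..
  also have "\<dots> = fdiff e ((fdiff d ^^ Suc k) f) x"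
    unfolding fdiff_def[of e] funpow_fdiff_Suc by (simp add: add_ac)
  finally show ?case .
qed simp

lemma fdiff_multiple: "fdiff (real N * h) f x = (\<Sum>i<N. fdiff h f (x + real i * h))"
  by (induction N) (auto simp: fdiff_def algebra_simps)

text \<open>A difference with step \<open>N * h\<close> telescopes into \<open>N\<close> differences
  with step \<open>h\<close> at shifted points. The induction converts one factor at a time, as
  difference operators commute.\<close>

lemma fdiff_multiple_nonneg:
  assumes "h > 0" "\<And>x. x > 0 \<Longrightarrow> 0 \<le> (fdiff h ^^ k) f x" "x > 0"
  shows "0 \<le> (fdiff (real N * h) ^^ k) f x"
  using assms(2,3)
proof (induction k arbitrary: f x)
  case (Suc k)
  have "0 \<le> (fdiff (real N * h) ^^ k) (fdiff (real N * h) f) x"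
  proof (rule Suc.IH)
    fix y :: real assume "y > 0"
    then have "0 \<le> (\<Sum>i<N. (fdiff h ^^ Suc k) f (y + real i * h))"
      by (intro sum_nonneg Suc.prems(1)) (use \<open>h > 0\<close> in \<open>auto intro: add_pos_nonneg\<close>)
    then show "0 \<le> (fdiff h ^^ k) (fdiff (real N * h) f) y"
      by (simp add: funpow_fdiff_commute fdiff_multiple)
  qed (use Suc.prems in auto)
  then show ?case by (simp add: funpow_fdiff_commute)
qed simp

lemma has_real_derivative_funpow_fdiff:
  assumes "\<And>x. x > 0 \<Longrightarrow> (F has_real_derivative f x) (at x)" "d > 0" "x > 0"
  shows "((fdiff d ^^ k) F has_real_derivative (fdiff d ^^ k) f x) (at x)"
  using assms(3)
proof (induction k arbitrary: x)
  case 0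
  then show ?case using assms(1) by simp
next
  case (Suc k)
  have "((\<lambda>x. (fdiff d ^^ k) F (x + d)) has_real_derivative (fdiff d ^^ k) f (x + d)) (at x)"
    using Suc.IH[of "x + d"] Suc.prems assms(2) by (simp add: DERIV_shift[symmetric])
  then show ?case
    using Suc.IH[OF Suc.prems] unfolding funpow_fdiff_Suc[abs_def] by (rule DERIV_diff)
qed

lemma continuous_on_funpow_fdiff:
  assumes "continuous_on {0<..} f" "d > 0"
  shows "continuous_on {0<..} ((fdiff d ^^ k) f)"
proof (induction k)
  case (Suc k)
  have "continuous_on {0<..} (\<lambda>x. (fdiff d ^^ k) f (x + d))"
    using \<open>d > 0\<close> by (intro continuous_on_compose2[OF Suc] continuous_intros) auto
  then show ?case
    unfolding funpow_fdiff_Suc[abs_def] using Suc by (rule continuous_on_diff)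
qed (use assms in simp)

section \<open>Continuity and convexity from midpoint inequalities\<close>

text \<open>Along \<open>x\<close>, \<open>x * r\<close>, \<open>x * r^2\<close>, ... the increments
  of \<open>f\<close> are nondecreasing, so \<open>N\<close> times the first is at most the total
  growth up to \<open>x * r ^ N\<close>. If \<open>r ^ N = 2\<close>, that growth is bounded
  locally, so the increment over a ratio \<open>r\<close> is of order 1 / N.\<close>

lemma mono_mult_midconvex_imp_continuous:
  fixes f :: "real \<Rightarrow> real"
  assumes mono: "\<And>x y. 0 < x \<Longrightarrow> x \<le> y \<Longrightarrow> f x \<le> f y"
    and mid: "\<And>x q. 0 < x \<Longrightarrow> 1 \<le> q \<Longrightarrow> 2 * f (x * q) \<le> f x + f (x * q * q)"
  shows "continuous_on {0<..} f"
proof -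
  have step: "f (x * r) - f x \<le> f (x * r ^ Suc k) - f (x * r ^ k)" if "x > 0" "r \<ge> 1" for x r k
  proof (induction k)
    case (Suc k)
    have "2 * f (x * r ^ k * r) \<le> f (x * r ^ k) + f (x * r ^ k * r * r)"
      by (rule mid) (use that in auto)
    then show ?case using Suc by (simp add: mult_ac)
  qed (simp add: mult_ac)
  have sum: "real N * (f (x * r) - f x) \<le> f (x * r ^ N) - f x" if "x > 0" "r \<ge> 1" for x r N
  proof (induction N)
    case (Suc N)
    then show ?case using step[OF that, of N] by (simp add: algebra_simps)
  qed simp
  have "isCont f x" if "x > 0" for x
    unfolding continuous_at_eps_delta
  proof (intro allI impI)
    fix e :: real assume "e > 0"
    \<comment> \<open>\<open>B\<close> bounds \<open>f (2 * y) - f y\<close> for all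
      \<open>y\<close> between \<open>x / 2\<close> and \<open>2 * x\<close>.\<close>
    define B where "B = f (4 * x) - f (x / 2)"
    have "B \<ge> 0" using mono[of "x/2" "4 * x"] that by (simp add: B_def)
    obtain N :: nat where N: "B / e < real N" using reals_Archimedean2 by blast
    moreover have "0 \<le> B / e" using \<open>B \<ge> 0\<close> \<open>e > 0\<close> by simp
    ultimately have "N > 0" by linarith
    define r where "r = root N 2"
    have r: "r > 1" "r ^ N = 2" "r \<le> 2"
      using \<open>N > 0\<close> real_root_le_iff[of N 2 "2 ^ N"] 
      by (auto simp: r_def real_root_power_cancel self_le_power)
    have est: "f z - f y < e" if "x / 2 \<le> y" "y \<le> 2 * x" "y \<le> z" "z \<le> y * r" for y z
    proof -
      have "y > 0" using that \<open>x > 0\<close> by linarith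
      have "f z - f y \<le> f (y * r) - f y" using mono[of z "y * r"] that \<open>y > 0\<close> by simp
      moreover have "real N * (f (y * r) - f y) \<le> f (y * 2) - f y"
        using sum[OF \<open>y > 0\<close>, of r N] r by simp
      moreover have "\<dots> \<le> B"
        using mono[of "x / 2" y] mono[of "y * 2" "4 * x"] that \<open>y > 0\<close> \<open>x > 0\<close> by (simp add: B_def)
      moreover have "B < e * real N" using N \<open>e > 0\<close> by (simp add: field_simps)
      ultimately have "real N * (f z - f y) < real N * e"
        using \<open>N > 0\<close> by (smt (verit) mult.commute mult_left_mono of_nat_0_le_iff)
      then show ?thesis using \<open>N > 0\<close> by simp
    qed
    \<comment> \<open>Within distance \<open>d\<close> of \<open>x\<close> a point differs from
      \<open>x\<close> by a ratio less than \<open>r\<close>.\<close>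
    define d where "d = min (x - x / r) (x * r - x)"
    have "d > 0" using r that by (simp add: d_def field_simps)
    show "\<exists>d>0. \<forall>x'. dist x' x < d \<longrightarrow> dist (f x') (f x) < e"
    proof (intro exI[of _ d] conjI allI impI)
      fix y assume "dist y x < d"
      then have y: "x / r < y" "y < x * r" by (auto simp: dist_real_def d_def)
      then have y': "x < y * r" using r by (simp add: field_simps)
      have "x / 2 \<le> x / r" using r that by (intro divide_left_mono) auto
      then have y0: "x / 2 \<le> y" using y by linarith
      show "dist (f y) (f x) < e"
      proof (cases "x \<le> y")
        case True
        then show ?thesis
          using est[of x y] mono[of x y] y that by (simp add: dist_real_def)
      next
        case False
        then show ?thesis
          using est[of y x] mono[of y x] y' y0 that by (simp add: dist_real_def)
      qed
    qed (fact \<open>d > 0\<close>)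
  qed
  then show ?thesis by (simp add: continuous_at_imp_continuous_on)
qed

text \<open>The arithmetic progression \<open>x\<close>, \<open>x * q\<close>,
  \<open>x * (2 * q - 1)\<close> ends below \<open>x * q * q\<close>, the gap being
  \<open>x * (q - 1)^2\<close>; so monotonicity turns the additive inequality into the
  multiplicative one.\<close>

lemma mono_midconvex_imp_continuous:
  fixes f :: "real \<Rightarrow> real"
  assumes mono: "\<And>x y. 0 < x \<Longrightarrow> x \<le> y \<Longrightarrow> f x \<le> f y"
    and mid: "\<And>x d. 0 < x \<Longrightarrow> 0 < d \<Longrightarrow> 2 * f (x + d) \<le> f x + f (x + 2 * d)"
  shows "continuous_on {0<..} f"
proof (rule mono_mult_midconvex_imp_continuous[OF mono])
  fix x q :: real assume xq: "0 < x" "1 \<le> q"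
  show "2 * f (x * q) \<le> f x + f (x * q * q)"
  proof (cases "q = 1")
    case False
    have "0 < x * (q - 1)" using xq False by simp
    then have "2 * f (x + x * (q - 1)) \<le> f x + f (x + 2 * (x * (q - 1)))"
      by (rule mid[OF xq(1)])
    moreover have "f (x + 2 * (x * (q - 1))) \<le> f (x * q * q)"
    proof (rule mono)
      have "0 \<le> x * (q - 1)\<^sup>2" using xq by simp
      then show "x + 2 * (x * (q - 1)) \<le> x * q * q"
        by (simp add: power2_eq_square algebra_simps)
      show "0 < x + 2 * (x * (q - 1))" using xq by (simp add: add_pos_nonneg)
    qed
    ultimately show ?thesis by (simp add: algebra_simps)
  qed simp
qed

text \<open>Subtracting the chord preserves midpoint convexity and leaves a function
  \<open>h\<close> vanishing at both ends, so it suffices that the maximum of \<open>h\<close>,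
  which exists by continuity, is not positive.\<close>

lemma midconvex_continuous_imp_convex:
  fixes f :: "real \<Rightarrow> real"
  assumes cont: "continuous_on {0<..} f"
    and mid: "\<And>x d. 0 < x \<Longrightarrow> 0 < d \<Longrightarrow> 2 * f (x + d) \<le> f x + f (x + 2 * d)"
  shows "convex_on {0<..} f"
proof (rule convex_on_linorderI)
  fix t x y :: real
  assume t: "0 < t" "t < 1" and xy: "x \<in> {0<..}" "y \<in> {0<..}" "x < y"
  define m where "m = (f y - f x) / (y - x)"
  define h where "h = (\<lambda>z. f z - (f x + m * (z - x)))"
  have hx: "h x = 0" and hy: "h y = 0" using xy by (simp_all add: h_def m_def)
  have hmid: "2 * h z \<le> h (z - d) + h (z + d)" if "0 < d" "x \<le> z - d" for z d
    using mid[of "z - d" d] that xy by (simp add: h_def algebra_simps)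
  have hcont: "continuous_on {x..y} h"
    unfolding h_def using xy by (intro continuous_intros continuous_on_subset[OF cont]) auto
  obtain z where z: "z \<in> {x..y}" "\<And>w. w \<in> {x..y} \<Longrightarrow> h w \<le> h z"
    using continuous_attains_sup[OF _ _ hcont] xy by auto
  have hz: "h z \<le> 0"
  proof (rule ccontr)
    assume pos: "\<not> h z \<le> 0"
    \<comment> \<open>The least maximizer of \<open>h\<close> contradicts midpoint convexity.\<close>
    define K where "K = {x..y} \<inter> h -` {h z}"
    have "closed K" unfolding K_def
      by (rule continuous_closed_preimage[OF hcont]) auto
    moreover have "K = K \<inter> {x..y}" by (auto simp: K_def)
    ultimately have "compact K" by (metis closed_Int_compact compact_Icc)
    moreover have "K \<noteq> {}" using z by (auto simp: K_def)
    ultimately obtain w where w: "w \<in> K" "\<And>v. v \<in> K \<Longrightarrow> w \<le> v"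
      using compact_attains_inf by metis
    have "w \<in> {x..y}" "h w = h z" using w by (auto simp: K_def)
    moreover have "w \<noteq> x" "w \<noteq> y" using pos hx hy \<open>h w = h z\<close> by auto
    ultimately have w': "x < w" "w < y" by auto
    define d where "d = min (w - x) (y - w)"
    have d: "0 < d" "x \<le> w - d" "w + d \<le> y" using w' by (auto simp: d_def)
    have "h (w - d) \<noteq> h z"
      using w(2)[of "w - d"] d w' by (auto simp: K_def)
    then have "h (w - d) < h z" using z(2)[of "w - d"] d w' by force
    moreover have "h (w + d) \<le> h z" using z(2)[of "w + d"] d w' by force
    ultimately show False using hmid[OF d(1,2)] \<open>h w = h z\<close> by linarith
  qed
  have "(1 - t) * x + t * y \<in> {x..y}"
    using t xy convex_bound_le[of x y y "1 - t" t] convex_bound_le[of "-x" "-x" "-y" "1-t" t]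
    by (auto simp: algebra_simps)
  then have "h ((1 - t) * x + t * y) \<le> 0" using z hz by force
  moreover have "m * ((1 - t) * x + t * y - x) = t * (f y - f x)"
  proof -
    have "m * ((1 - t) * x + t * y - x) = t * (m * (y - x))" by (simp add: algebra_simps)
    then show ?thesis using xy by (simp add: m_def)
  qed
  ultimately show "f ((1 - t) *\<^sub>R x + t *\<^sub>R y) \<le> (1 - t) * f x + t * f y"
    by (simp add: h_def algebra_simps)
qed simp

lemma fdiff_nonneg_consequences:
  assumes "\<And>j d x. j \<le> 2 \<Longrightarrow> d > 0 \<Longrightarrow> x > 0 \<Longrightarrow> 0 \<le> (fdiff d ^^ j) f x"
  shows "\<And>x y. 0 < x \<Longrightarrow> x \<le> y \<Longrightarrow> f x \<le> f y" (is "PROP ?mono")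
    and "continuous_on {0<..} f" and "convex_on {0<..} f"
proof -
  show mono: "PROP ?mono"
  proof -
    fix x y :: real assume "0 < x" "x \<le> y"
    then show "f x \<le> f y"
      using assms[of 1 "y - x" x] by (cases "x = y") (auto simp: fdiff_def)
  qed
  have mid: "2 * f (x + d) \<le> f x + f (x + 2 * d)" if "0 < x" "0 < d" for x d
    using assms[of 2 d x] that by (simp add: fdiff_def numeral_2_eq_2 algebra_simps)
  show "continuous_on {0<..} f"
    by (rule mono_midconvex_imp_continuous[OF mono mid])
  then show "convex_on {0<..} f"
    by (rule midconvex_continuous_imp_convex[OF _ mid])
qed

section \<open>Right derivatives of convex functions\<close>

text \<open>For \<open>f\<close> nondecreasing and convex on the positive reals, the slopes at
  \<open>x > 0\<close> are nonnegative and nondecreasing in \<open>h\<close>, so this infimum is the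
  right derivative.\<close>

definition right_slope :: "(real \<Rightarrow> real) \<Rightarrow> real \<Rightarrow> real" where
  "right_slope f x = (INF h\<in>{0<..}. (f (x + h) - f x) / h)"

context
  fixes f :: "real \<Rightarrow> real"
  assumes mono: "\<And>x y. 0 < x \<Longrightarrow> x \<le> y \<Longrightarrow> f x \<le> f y"
    and conv: "convex_on {0<..} f"
begin

lemma slope_mono:
  assumes "0 < x" "0 < h" "h \<le> k"
  shows "(f (x + h) - f x) / h \<le> (f (x + k) - f x) / k"
proof (cases "h = k")
  case False
  then show ?thesis
    using convex_on_slope_le(1)[OF conv, of x "x + k" "x + h"] assms
    by (simp add: minus_divide_divide[of "f (x + _) - f x", symmetric])
qed simp

lemma right_slope_le:
  assumes "0 < x" "0 < h"
  shows "right_slope f x \<le> (f (x + h) - f x) / h"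
  unfolding right_slope_def
proof (rule cINF_lower)
  show "bdd_below ((\<lambda>h. (f (x + h) - f x) / h) ` {0<..})"
    by (rule bdd_belowI2[of _ 0]) (use mono[of x] assms in auto)
qed (use assms in auto)

lemma slope_le_right_slope:
  assumes "0 < x" "x < y"
  shows "(f y - f x) / (y - x) \<le> right_slope f y"
  unfolding right_slope_def
proof (rule cINF_greatest)
  fix h :: real assume "h \<in> {0<..}"
  then show "(f y - f x) / (y - x) \<le> (f (y + h) - f y) / h"
    using convex_on_slope_le[OF conv, of x "y + h" y] assms
    by (simp add: minus_divide_divide[of "f y - f x", symmetric]
        minus_divide_divide[of "f (y + h) - f y", symmetric])
qed auto

text \<open>By monotonicity of the slopes, a single step with slope below \<open>a\<close> forces
  slopes below \<open>a\<close> for all smaller steps.\<close>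

lemma slope_tendsto_right_slope:
  assumes "0 < x"
  shows "((\<lambda>h. (f (x + h) - f x) / h) \<longlongrightarrow> right_slope f x) (at_right 0)"
proof (rule order_tendstoI)
  fix a assume "a < right_slope f x"
  then show "\<forall>\<^sub>F h in at_right 0. a < (f (x + h) - f x) / h"
    using right_slope_le[OF assms]
    by (intro eventually_at_rightI[of 0 1]) (auto intro: less_le_trans)
next
  fix a assume a: "right_slope f x < a"
  have "\<exists>h>0. (f (x + h) - f x) / h < a"
  proof (rule ccontr)
    assume none: "\<not> ?thesis"
    have "a \<le> (f (x + h) - f x) / h" if "h > 0" for h
      using none that not_less by blast
    then have "a \<le> right_slope f x"
      unfolding right_slope_def by (intro cINF_greatest) auto
    then show False using a by simp
  qed
  then obtain k where "k > 0" "(f (x + k) - f x) / k < a" by blast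
  then show "\<forall>\<^sub>F h in at_right 0. (f (x + h) - f x) / h < a"
    using slope_mono[OF assms] by (intro eventually_at_rightI[of 0 k]) (auto intro: le_less_trans less_imp_le)
qed

text \<open>The slope of the chord between two points lies between the right derivatives at these
  points, on either side of \<open>x\<close>; continuity of the right derivative then squeezes
  it.\<close>

lemma has_real_derivative_right_slope:
  assumes "continuous_on {0<..} (right_slope f)" "0 < x"
  shows "(f has_real_derivative right_slope f x) (at x)"
proof -
  let ?g = "right_slope f"
  have slope: "min (?g x) (?g y) \<le> (f y - f x) / (y - x) \<and> (f y - f x) / (y - x) \<le> max (?g x) (?g y)"
    if "y > 0" "y \<noteq> x" for y
  proof (cases "x < y")
    case True
    then show ?thesis
      using right_slope_le[of x "y - x"] slope_le_right_slope[of x y] assms(2) by auto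
  next
    case False
    then have "y < x" using that by simp
    moreover have "(f y - f x) / (y - x) = (f x - f y) / (x - y)"
      by (metis minus_diff_eq minus_divide_divide)
    ultimately show ?thesis
      using right_slope_le[of y "x - y"] slope_le_right_slope[of y x] that by auto
  qed
  have ev: "\<forall>\<^sub>F y in at x. y > 0 \<and> y \<noteq> x"
    using eventually_at_in_open'[of "{0<..}" x] eventually_neq_at_within[of x x UNIV] assms(2)
    by (auto elim: eventually_elim2)
  have "(?g \<longlongrightarrow> ?g x) (at x)"
    using assms by (simp add: continuous_on_eq_continuous_at isCont_def)
  then have lim: "((\<lambda>y. min (?g x) (?g y)) \<longlongrightarrow> min (?g x) (?g x)) (at x)"
    "((\<lambda>y. max (?g x) (?g y)) \<longlongrightarrow> max (?g x) (?g x)) (at x)"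
    by (intro tendsto_intros; assumption)+
  have "\<forall>\<^sub>F y in at x. min (?g x) (?g y) \<le> (f y - f x) / (y - x)"
    "\<forall>\<^sub>F y in at x. (f y - f x) / (y - x) \<le> max (?g x) (?g y)"
    using ev by (eventually_elim; use slope in blast)+
  then have "((\<lambda>y. (f y - f x) / (y - x)) \<longlongrightarrow> ?g x) (at x)"
    using lim unfolding min.idem max.idem by (rule tendsto_sandwich)
  then show ?thesis by (simp add: has_field_derivative_iff)
qed

end

lemma funpow_fdiff_tendsto:
  assumes "\<And>x. 0 < x \<Longrightarrow> ((\<lambda>n. F n x) \<longlongrightarrow> g x) net" "0 < d" "0 < x"
  shows "((\<lambda>n. (fdiff d ^^ k) (F n) x) \<longlongrightarrow> (fdiff d ^^ k) g x) net"
  using assms(3)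
proof (induction k arbitrary: x)
  case (Suc k)
  have "((\<lambda>n. (fdiff d ^^ k) (F n) (x + d) - (fdiff d ^^ k) (F n) x)
    \<longlongrightarrow> (fdiff d ^^ k) g (x + d) - (fdiff d ^^ k) g x) net"
    using Suc.prems assms(2) by (intro tendsto_diff Suc.IH) auto
  then show ?case by (simp only: funpow_fdiff_Suc)
qed (use assms in simp)

lemma funpow_fdiff_divide: "(fdiff d ^^ k) (\<lambda>x. f x / c) x = (fdiff d ^^ k) f x / c"
  by (induction k arbitrary: x) (auto simp: funpow_fdiff_Suc diff_divide_distrib simp del: funpow.simps(2))

text \<open>The right derivative is a limit of quotients \<open>fdiff h f / h\<close>, and the
  \<open>k\<close>-th difference of such a quotient mixes the steps \<open>d\<close> and
  \<open>h\<close>, whereas \<open>pos\<close> concerns a single step. Commensurable steps reduce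
  the mixed differences to sums of unmixed ones.\<close>

lemma right_slope_fdiff_nonneg:
  assumes pos: "\<And>j d x. j \<le> Suc k \<Longrightarrow> d > 0 \<Longrightarrow> x > 0 \<Longrightarrow> 0 \<le> (fdiff d ^^ j) f x"
    and "convex_on {0<..} f" "d > 0" "x > 0"
  shows "0 \<le> (fdiff d ^^ k) (right_slope f) x"
proof (rule tendsto_lowerbound)
  have mono: "f u \<le> f v" if "0 < u" "u \<le> v" for u v
    using pos[of 1 "v - u" u] that by (cases "u = v") (auto simp: fdiff_def)
  \<comment> \<open>Steps dividing \<open>d\<close>, so that a difference with step \<open>d\<close> is a sum of differences with step \<open>h n\<close>.\<close>
  define h where "h = (\<lambda>n. d / real (Suc n))"
  have h: "h n > 0" "real (Suc n) * h n = d" for n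
    using assms(3) by (simp_all add: h_def)
  then have "h n \<noteq> 0" for n by (metis less_irrefl)
  have "filterlim h (at_right 0) sequentially"
    unfolding filterlim_at
  proof
    show "(h \<longlonglongrightarrow> 0)"
      using tendsto_mult[OF tendsto_const[of d] LIMSEQ_inverse_real_of_nat]
      by (simp add: h_def divide_inverse)
  qed (use h \<open>h _ \<noteq> 0\<close> in auto)
  moreover have "((\<lambda>h. (f (x + h) - f x) / h) \<longlongrightarrow> right_slope f x) (at_right 0)" if "x > 0" for x
    by (rule slope_tendsto_right_slope[OF mono assms(2) that])
  ultimately have "((\<lambda>n. (f (x + h n) - f x) / h n) \<longlonglongrightarrow> right_slope f x)" if "x > 0" for x
    using that filterlim_compose by blast
  then have "((\<lambda>n. fdiff (h n) f x / h n) \<longlonglongrightarrow> right_slope f x)" if "x > 0" for x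
    using that by (simp add: fdiff_def)
  then show "((\<lambda>n. (fdiff d ^^ k) (\<lambda>x. fdiff (h n) f x / h n) x)
    \<longlonglongrightarrow> (fdiff d ^^ k) (right_slope f) x)"
    using assms by (intro funpow_fdiff_tendsto) auto
  have "0 \<le> (fdiff (real (Suc n) * h n) ^^ k) (fdiff (h n) f) x" for n
  proof (rule fdiff_multiple_nonneg[OF h(1)])
    fix y :: real assume "y > 0"
    then show "0 \<le> (fdiff (h n) ^^ k) (fdiff (h n) f) y"
      using pos[of "Suc k" "h n" y] h(1)[of n] by (simp add: funpow_fdiff_commute)
  qed (fact assms(4))
  then show "\<forall>\<^sub>F n in sequentially. 0 \<le> (fdiff d ^^ k) (\<lambda>x. fdiff (h n) f x / h n) x"
    using h by (simp add: funpow_fdiff_divide less_imp_le)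
qed simp

section \<open>Regularity from nonnegative differences\<close>

lemma funpow_deriv_cong:
  assumes "open S" "\<And>x. x \<in> S \<Longrightarrow> f x = g x" "x \<in> S"
  shows "(deriv ^^ k) f x = (deriv ^^ k) g x"
  using assms(3)
proof (induction k arbitrary: x)
  case (Suc k)
  have "\<forall>\<^sub>F y in nhds x. (deriv ^^ k) f y = (deriv ^^ k) g y"
    using eventually_nhds_in_open[OF assms(1) Suc.prems] Suc.IH by (rule eventually_mono)
  then show ?case by (simp add: deriv_cong_ev)
qed (use assms in simp)

lemma differentiable_cong_on_open:
  fixes f g :: "real \<Rightarrow> real"
  assumes "open S" "\<And>x. x \<in> S \<Longrightarrow> f x = g x" "x \<in> S" "f differentiable at x"
  shows "g differentiable at x"
  using assms unfolding differentiable_def 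
  by (metis has_derivative_transform_within_open)

text \<open>On the open set \<open>S\<close> the function \<open>deriv f\<close> agrees with
  \<open>g\<close>, hence so do all further derivatives, which depend only on values near the
  point.\<close>

lemma Ck_on_Suc:
  assumes "open S" "\<And>x. x \<in> S \<Longrightarrow> (f has_real_derivative g x) (at x)" "Ck_on k g S"
  shows "Ck_on (Suc k) f S"
proof -
  have eq: "(deriv ^^ Suc j) f x = (deriv ^^ j) g x" if "x \<in> S" for j x
  proof -
    have "(deriv ^^ j) (deriv f) x = (deriv ^^ j) g x"
      by (rule funpow_deriv_cong[OF assms(1) _ that]) (intro DERIV_imp_deriv assms(2))
    then show ?thesis by (simp add: funpow_Suc_right del: funpow.simps)
  qed
  have "(deriv ^^ j) f differentiable at x" if "j < Suc k" "x \<in> S" for j x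
  proof (cases j)
    case 0
    then show ?thesis
      using assms(2)[OF that(2)] by (auto simp: real_differentiable_def)
  next
    case (Suc i)
    then have "(deriv ^^ i) g differentiable at x"
      using assms(3) that by (simp add: Ck_on_def)
    then show ?thesis
      unfolding Suc
      by (rule differentiable_cong_on_open[OF assms(1) _ that(2), rotated]) (rule eq[symmetric])
  qed
  moreover have "continuous_on S ((deriv ^^ Suc k) f)"
    using assms(3) by (subst continuous_on_cong[OF refl eq]) (auto simp: Ck_on_def)
  ultimately show ?thesis by (auto simp: Ck_on_def simp del: funpow.simps)
qed

text \<open>Each passage to the right derivative costs one order of differences. The last two orders
  supply continuity and convexity; continuity of the right derivative also makes it the true
  derivative.\<close>

lemma fdiff_nonneg_imp_regular:
  assumes "\<And>j d x. j \<le> k + 2 \<Longrightarrow> d > 0 \<Longrightarrow> x > 0 \<Longrightarrow> 0 \<le> (fdiff d ^^ j) f x"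
  shows "Ck_on k f {0<..} \<and> convex_on {0<..} ((deriv ^^ k) f)"
  using assms
proof (induction k arbitrary: f)
  case 0
  then show ?case using fdiff_nonneg_consequences[of f] by (simp add: Ck_on_def)
next
  case (Suc k)
  have mono: "\<And>x y. 0 < x \<Longrightarrow> x \<le> y \<Longrightarrow> f x \<le> f y" and conv: "convex_on {0<..} f"
    using fdiff_nonneg_consequences[of f] Suc.prems by auto
  define g where "g = right_slope f"
  have pos: "0 \<le> (fdiff d ^^ j) g x" if "j \<le> k + 2" "d > 0" "x > 0" for j d x
    unfolding g_def using that Suc.prems by (intro right_slope_fdiff_nonneg conv) auto
  have "continuous_on {0<..} g"
    using fdiff_nonneg_consequences(2)[of g] pos by auto
  then have deriv: "(f has_real_derivative g x) (at x)" if "x > 0" for x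
    unfolding g_def using that has_real_derivative_right_slope[OF mono conv] by simp
  have eq: "(deriv ^^ Suc k) f x = (deriv ^^ k) g x" if "x > 0" for x
  proof -
    have "(deriv ^^ k) (deriv f) x = (deriv ^^ k) g x"
      using that by (intro funpow_deriv_cong[of "{0<..}"]) (auto intro: DERIV_imp_deriv deriv)
    then show ?thesis by (simp add: funpow_Suc_right del: funpow.simps)
  qed
  have g: "Ck_on k g {0<..}" "convex_on {0<..} ((deriv ^^ k) g)"
    using Suc.IH[of g] pos by auto
  have "convex_on {0<..} ((deriv ^^ Suc k) f)"
  proof (rule convex_onI)
    fix t x y :: real
    assume t: "0 < t" "t < 1" and xy: "x \<in> {0<..}" "y \<in> {0<..}"
    then have "(1 - t) * x + t * y > 0" by (intro add_pos_pos mult_pos_pos) auto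
    then show "(deriv ^^ Suc k) f ((1 - t) *\<^sub>R x + t *\<^sub>R y)
      \<le> (1 - t) * (deriv ^^ Suc k) f x + t * (deriv ^^ Suc k) f y"
      using convex_onD[OF g(2), of t x y] t xy by (simp add: eq del: funpow.simps)
  qed simp
  moreover have "Ck_on (Suc k) f {0<..}"
    by (rule Ck_on_Suc[OF _ _ g(1)]) (use deriv in auto)
  ultimately show ?case by blast
qed

section \<open>Hankel forms\<close>

text \<open>At equally spaced nodes \<open>a + i * e\<close>, the power
  \<open>u powr (x + y)\<close> becomes a constant times \<open>(u powr e) ^ (i + j)\<close>. Taking
  \<open>u = q powr (1 / e)\<close> and absorbing the constant into the coefficient gives any
  prescribed \<open>q\<close> and \<open>c\<close>. Equal row and column nodes yield the principal
  minors.\<close>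

lemma TN_imp_hankel_form_nonneg:
  fixes f :: "real \<Rightarrow> real" and q1 q2 c1 c2 :: real
  assumes "is_interval X0" "\<exists>a\<in>X0. \<exists>b\<in>X0. a < b"
    and TN: "\<forall>u1 u2 c1 c2 :: real. u1 > 0 \<longrightarrow> u2 > 0 \<longrightarrow> c1 \<ge> 0 \<longrightarrow> c2 \<ge> 0 \<longrightarrow> c1 + c2 > 0 \<longrightarrow>
      TN p X0 (\<lambda>x y. f (c1 * u1 powr (x + y) + c2 * u2 powr (x + y)))"
    and "n \<le> p" "q1 > 0" "q2 > 0" "c1 \<ge> 0" "c2 \<ge> 0" "c1 + c2 > 0"
  shows "0 \<le> (\<Sum>i<n. \<Sum>j<n. w i * w j * f (c1 * q1 ^ (i + j) + c2 * q2 ^ (i + j)))"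
proof (cases "n = 0")
  case False
  obtain a b where ab: "a \<in> X0" "b \<in> X0" "a < b" using assms(2) by blast
  \<comment> \<open>This spacing keeps the nodes with index below \<open>p\<close> between
    \<open>a\<close> and \<open>b\<close>.\<close>
  define e where "e = (b - a) / real p"
  define x where "x i = a + real i * e" for i
  have "p > 0" using False \<open>n \<le> p\<close> by simp
  then have "e > 0" using ab by (simp add: e_def)
  have x_in: "x i \<in> X0" if "i < p" for i
  proof (rule mem_is_interval_1_I[OF assms(1) ab(1,2)])
    have "real i * (b - a) \<le> real p * (b - a)"
      using that ab by (intro mult_right_mono) auto
    then have "real i * e \<le> b - a"
      using \<open>p > 0\<close> by (simp add: e_def divide_le_eq mult.commute)
    then show "a \<le> x i" "x i \<le> b"
      using \<open>e > 0\<close> by (simp_all add: x_def)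
  qed
  have reparam: "c / (q powr (1 / e)) powr (2 * a) * (q powr (1 / e)) powr (x i + x j) = c * q ^ (i + j)"
    if "q > 0" for c q i j
  proof -
    have "(q powr (1 / e)) powr (x i + x j)
      = (q powr (1 / e)) powr (2 * a) * (q powr (1 / e)) powr (real (i + j) * e)"
      by (simp add: x_def powr_add[symmetric] algebra_simps)
    moreover have "(q powr (1 / e)) powr (real (i + j) * e) = q ^ (i + j)"
      using \<open>e > 0\<close> powr_realpow[OF that, of "i + j"] by (simp add: powr_powr)
    ultimately show ?thesis using that by simp
  qed
  show ?thesis
  proof (rule psd_of_principal_minors)
    fix r and s :: "nat \<Rightarrow> nat"
    assume r: "1 \<le> r" and s: "strict_mono_on {..<r} s" "s ` {..<r} \<subseteq> {..<n}"
    have "r \<le> n"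
      using card_inj_on_le[OF strict_mono_on_imp_inj_on[OF s(1)] s(2)] by simp
    define u where "u q = q powr (1 / e)" for q :: real
    define d where "d c q = c / u q powr (2 * a)" for c q :: real
    have u_pos: "u q > 0" if "q > 0" for q using that by (simp add: u_def)
    have d_nonneg: "d c q \<ge> 0" if "c \<ge> 0" for c q using that by (simp add: d_def)
    have d_pos: "d c q > 0" if "c > 0" "q > 0" for c q
      using that by (simp add: d_def u_def)
    \<comment> \<open>The two coefficients are rescaled by different factors, so positivity of their
      sum has to be rechecked.\<close>
    have "c1 > 0 \<or> c2 > 0" using assms(7-9) by linarith
    then have "d c1 q1 + d c2 q2 > 0"
    proof
      assume "c1 > 0"
      then show ?thesis using d_pos[of c1 q1] d_nonneg[of c2 q2] assms by linarith
    next
      assume "c2 > 0"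
      then show ?thesis using d_pos[of c2 q2] d_nonneg[of c1 q1] assms by linarith
    qed
    then have TN_u: "TN p X0 (\<lambda>x y. f (d c1 q1 * u q1 powr (x + y) + d c2 q2 * u q2 powr (x + y)))"
      using TN u_pos[OF assms(5)] u_pos[OF assms(6)] d_nonneg[OF assms(7)] d_nonneg[OF assms(8)]
      by blast
    have "x (s i) \<in> X0" if "i < r" for i
    proof (rule x_in)
      have "s i \<in> {..<n}" using s(2) that by blast
      then show "s i < p" using \<open>n \<le> p\<close> by simp
    qed
    moreover have "x (s i) < x (s (Suc i))" if "Suc i < r" for i
    proof -
      have "s i < s (Suc i)"
        by (rule strict_mono_onD[OF s(1)]) (use that in auto)
      then show ?thesis using \<open>e > 0\<close> by (simp add: x_def)
    qed
    ultimately have "0 \<le> ldet r (\<lambda>i j. f (d c1 q1 * u q1 powr (x (s i) + x (s j))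
        + d c2 q2 * u q2 powr (x (s i) + x (s j))))"
      using TN_u[unfolded TN_def, rule_format, of r "\<lambda>i. x (s i)" "\<lambda>i. x (s i)"]
        r \<open>r \<le> n\<close> \<open>n \<le> p\<close> by simp
    then show "0 \<le> ldet r (\<lambda>i j. f (c1 * q1 ^ (s i + s j) + c2 * q2 ^ (s i + s j)))"
      unfolding d_def u_def reparam[OF assms(5)] reparam[OF assms(6)] .
  qed (simp add: add.commute)
qed simp

text \<open>The case \<open>q1 = 1\<close>, \<open>q2 = 2\<close> of the two-term form:
  \<open>a\<close> stays fixed as a Taylor centre while \<open>t\<close> tends to 0.\<close>

definition hankel_nonneg :: "nat \<Rightarrow> (real \<Rightarrow> real) \<Rightarrow> bool" where
  "hankel_nonneg n f \<longleftrightarrow>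
    (\<forall>a>0. \<forall>t>0. \<forall>w. 0 \<le> (\<Sum>i<n. \<Sum>j<n. w i * w j * f (a + t * 2 ^ (i + j))))"

text \<open>Lagrange remainder; the upper bound on \<open>z\<close> is not strict so that
  \<open>N = 0\<close> is covered, with \<open>z = a + h\<close>.\<close>

lemma Taylor_remainder_right:
  fixes D :: "nat \<Rightarrow> real \<Rightarrow> real"
  assumes "\<And>j x. j < N \<Longrightarrow> a \<le> x \<Longrightarrow> (D j has_real_derivative D (Suc j) x) (at x)" "h > 0"
  shows "\<exists>z. a < z \<and> z \<le> a + h \<and>
    D 0 (a + h) = (\<Sum>m<N. D m a / fact m * h ^ m) + D N z / fact N * h ^ N"
proof (cases "N = 0")
  case False
  then show ?thesis
    using Taylor_up[of N D "D 0" a "a + h" a] assms by (auto intro: less_imp_le)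
qed (use assms in \<open>auto intro!: exI[of _ "a + h"]\<close>)

text \<open>The weights are the coefficients of the polynomial \<open>P\<close> with roots
  \<open>2 ^ k\<close> for \<open>k < N\<close>. They annihilate the Taylor terms of order below
  \<open>N\<close>, so the form is \<open>t ^ N / fact N\<close> times a remainder sum that tends to
  \<open>(poly P (2 ^ N))^2 * D N a\<close>.\<close>

lemma hankel_nonneg_imp_last_deriv_nonneg:
  fixes D :: "nat \<Rightarrow> real \<Rightarrow> real"
  assumes nonneg: "hankel_nonneg (Suc N) (D 0)"
    and deriv: "\<And>j x. j < N \<Longrightarrow> x > 0 \<Longrightarrow> (D j has_real_derivative D (Suc j) x) (at x)"
    and cont: "continuous_on {0<..} (D N)"
    and "a > 0"
  shows "0 \<le> D N a"
proof -
  define P :: "real poly" where "P = (\<Prod>k<N. [:- (2 ^ k), 1:])"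
  have degP: "degree P = N"
    unfolding P_def by (subst degree_prod_eq_sum_degree) auto
  have zeroP: "poly P (2 ^ m) = 0" if "m < N" for m
    using that by (auto simp: P_def poly_prod)
  have posP: "poly P (2 ^ N) \<noteq> 0"
    by (auto simp: P_def poly_prod)
  define w where "w = Polynomial.coeff P"
  \<comment> \<open>The double sum factors because \<open>2 ^ (i + j)\<close> is a product of a term
    in \<open>i\<close> and a term in \<open>j\<close>.\<close>
  have moment: "(\<Sum>i<Suc N. \<Sum>j<Suc N. w i * w j * (2 ^ (i + j)) ^ m) = (poly P (2 ^ m))\<^sup>2" for m
  proof -
    have "poly P (2 ^ m) = (\<Sum>i<Suc N. w i * (2 ^ i) ^ m)"
      by (simp add: poly_altdef degP w_def lessThan_Suc_atMost power_mult[symmetric] mult.commute)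
    then show ?thesis
      by (simp add: power2_eq_square sum_product power_add power_mult_distrib mult_ac
          del: sum.lessThan_Suc)
  qed
  have "\<forall>h\<in>{0<..}. \<exists>z. a < z \<and> z \<le> a + h \<and>
      D 0 (a + h) = (\<Sum>m<N. D m a / fact m * h ^ m) + D N z / fact N * h ^ N"
    using deriv \<open>a > 0\<close> by (intro ballI Taylor_remainder_right) auto
  from bchoice[OF this] obtain z where z: "\<And>h. h > 0 \<Longrightarrow> a < z h \<and> z h \<le> a + h \<and>
      D 0 (a + h) = (\<Sum>m<N. D m a / fact m * h ^ m) + D N (z h) / fact N * h ^ N"
    by auto
  then have z_bounds: "a \<le> z h" "z h \<le> a + h" if "h > 0" for h
    using that by (meson less_imp_le)+
  define R where "R t = (\<Sum>i<Suc N. \<Sum>j<Suc N.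
    w i * w j * (2 ^ (i + j)) ^ N * D N (z (t * 2 ^ (i + j))))" for t
  have R_nonneg: "0 \<le> R t" if "t > 0" for t
  proof -
    have "0 \<le> (\<Sum>i<Suc N. \<Sum>j<Suc N. w i * w j * D 0 (a + t * 2 ^ (i + j)))"
      using nonneg that \<open>a > 0\<close> by (simp add: hankel_nonneg_def del: sum.lessThan_Suc)
    also have "\<dots> = (\<Sum>i<Suc N. \<Sum>j<Suc N.
        (\<Sum>m<N. D m a / fact m * t ^ m * (w i * w j * (2 ^ (i + j)) ^ m))
        + t ^ N / fact N * (w i * w j * (2 ^ (i + j)) ^ N * D N (z (t * 2 ^ (i + j)))))"
    proof (intro sum.cong refl)
      fix i j
      have taylor: "y * D 0 (a + t * q) = (\<Sum>m<N. D m a / fact m * t ^ m * (y * q ^ m))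
          + t ^ N / fact N * (y * q ^ N * D N (z (t * q)))" if "q > 0" for y q
      proof -
        have "t * q > 0" using \<open>t > 0\<close> that by simp
        note eq = conjunct2[OF conjunct2[OF z[OF this]]]
        show ?thesis
          unfolding eq distrib_left sum_distrib_left
          by (intro arg_cong2[of _ _ _ _ "(+)"] sum.cong refl) (simp_all add: power_mult_distrib)
      qed
      show "w i * w j * D 0 (a + t * 2 ^ (i + j))
        = (\<Sum>m<N. D m a / fact m * t ^ m * (w i * w j * (2 ^ (i + j)) ^ m))
        + t ^ N / fact N * (w i * w j * (2 ^ (i + j)) ^ N * D N (z (t * 2 ^ (i + j))))"
        by (rule taylor) simp
    qed
    also have "\<dots> = (\<Sum>m<N. D m a / fact m * t ^ m * (poly P (2 ^ m))\<^sup>2) + t ^ N / fact N * R t"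
    proof -
      have "(\<Sum>i<Suc N. \<Sum>j<Suc N. \<Sum>m<N. D m a / fact m * t ^ m * (w i * w j * (2 ^ (i + j)) ^ m))
        = (\<Sum>i<Suc N. \<Sum>m<N. \<Sum>j<Suc N. D m a / fact m * t ^ m * (w i * w j * (2 ^ (i + j)) ^ m))"
        by (rule sum.cong[OF refl], rule sum.swap)
      also have "\<dots> = (\<Sum>m<N. \<Sum>i<Suc N. \<Sum>j<Suc N. D m a / fact m * t ^ m * (w i * w j * (2 ^ (i + j)) ^ m))"
        by (rule sum.swap)
      also have "\<dots> = (\<Sum>m<N. D m a / fact m * t ^ m * (poly P (2 ^ m))\<^sup>2)"
        unfolding sum_distrib_left[symmetric] moment ..
      finally show ?thesis
        unfolding sum.distrib R_def sum_distrib_left by simp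
    qed
    also have "\<dots> = t ^ N / fact N * R t"
      using zeroP by simp
    finally have "t ^ N / fact N * 0 \<le> t ^ N / fact N * R t"
      by (simp only: mult_zero_right)
    then show ?thesis
      by (rule mult_left_le_imp_le) (use that in simp)
  qed
  \<comment> \<open>The intermediate points are squeezed to \<open>a\<close>; only continuity of
    \<open>D N\<close> is used here, not differentiability.\<close>
  have "((\<lambda>t. D N (z (t * 2 ^ k))) \<longlongrightarrow> D N a) (at_right 0)" for k
  proof -
    have "((\<lambda>t. z (t * 2 ^ k)) \<longlongrightarrow> a) (at_right 0)"
    proof (rule tendsto_sandwich)
      show "\<forall>\<^sub>F t in at_right 0. a \<le> z (t * 2 ^ k)"
        using z_bounds(1) by (intro eventually_at_rightI[of 0 1]) auto
      show "\<forall>\<^sub>F t in at_right 0. z (t * 2 ^ k) \<le> a + t * 2 ^ k"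
        using z_bounds(2) by (intro eventually_at_rightI[of 0 1]) auto
      have "((\<lambda>t. a + t * 2 ^ k) \<longlongrightarrow> a + 0 * 2 ^ k) (at_right (0::real))"
        by (intro tendsto_intros)
      then show "((\<lambda>t. a + t * 2 ^ k) \<longlongrightarrow> a) (at_right (0::real))" by simp
    qed simp
    moreover have "isCont (D N) a"
      using cont \<open>a > 0\<close> by (simp add: continuous_on_eq_continuous_at)
    ultimately show ?thesis by (rule isCont_tendsto_compose[rotated])
  qed
  then have "(R \<longlongrightarrow> (\<Sum>i<Suc N. \<Sum>j<Suc N. w i * w j * (2 ^ (i + j)) ^ N * D N a)) (at_right 0)"
    unfolding R_def by (intro tendsto_intros)
  moreover have "\<forall>\<^sub>F t in at_right 0. 0 \<le> R t"
    using R_nonneg by (intro eventually_at_rightI[of 0 1]) auto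
  ultimately have "0 \<le> (\<Sum>i<Suc N. \<Sum>j<Suc N. w i * w j * (2 ^ (i + j)) ^ N * D N a)"
    by (rule tendsto_lowerbound) simp
  also have "\<dots> = (poly P (2 ^ N))\<^sup>2 * D N a"
    unfolding moment[symmetric] sum_distrib_right ..
  finally show ?thesis
    using posP by (simp add: zero_le_mult_iff)
qed

text \<open>Pad the weights with zeros.\<close>

lemma hankel_nonneg_mono:
  assumes "hankel_nonneg n f" "m \<le> n"
  shows "hankel_nonneg m f"
  unfolding hankel_nonneg_def
proof (intro allI impI)
  fix a t :: real and w :: "nat \<Rightarrow> real"
  assume "a > 0" "t > 0"
  define v where "v i = (if i < m then w i else 0)" for i
  have "0 \<le> (\<Sum>i<n. \<Sum>j<n. v i * v j * f (a + t * 2 ^ (i + j)))"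
    using assms(1) \<open>a > 0\<close> \<open>t > 0\<close> by (simp add: hankel_nonneg_def)
  also have "\<dots> = (\<Sum>i<m. \<Sum>j<m. w i * w j * f (a + t * 2 ^ (i + j)))"
  proof -
    have "(\<Sum>j<n. v i * v j * g j) = (\<Sum>j<m. v i * w j * g j)" for i and g :: "nat \<Rightarrow> real"
      using assms(2) by (intro sum.mono_neutral_cong_right) (auto simp: v_def)
    then have "(\<Sum>i<n. \<Sum>j<n. v i * v j * f (a + t * 2 ^ (i + j)))
      = (\<Sum>i<n. \<Sum>j<m. v i * w j * f (a + t * 2 ^ (i + j)))" by simp
    also have "\<dots> = (\<Sum>i<m. \<Sum>j<m. w i * w j * f (a + t * 2 ^ (i + j)))"
      using assms(2) by (intro sum.mono_neutral_cong_right) (auto simp: v_def)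
    finally show ?thesis .
  qed
  finally show "0 \<le> (\<Sum>i<m. \<Sum>j<m. w i * w j * f (a + t * 2 ^ (i + j)))" .
qed

section \<open>Smoothing by antiderivatives\<close>

text \<open>Shift the base point \<open>a\<close> of the form of \<open>F\<close> by
  \<open>s\<close>. The derivative in \<open>s\<close> is the form of \<open>f\<close> at
  \<open>a + s\<close>, hence nonnegative, and the increment from \<open>s = 0\<close> to
  \<open>s = d\<close> is the form of \<open>fdiff d F\<close>.\<close>

lemma hankel_nonneg_fdiff:
  assumes "hankel_nonneg n f" "\<And>x. x > 0 \<Longrightarrow> (F has_real_derivative f x) (at x)" "d > 0"
  shows "hankel_nonneg n (fdiff d F)"
  unfolding hankel_nonneg_def
proof (intro allI impI)
  fix a t :: real and w :: "nat \<Rightarrow> real"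
  assume at: "a > 0" "t > 0"
  define G where "G s = (\<Sum>i<n. \<Sum>j<n. w i * w j * F (a + s + t * 2 ^ (i + j)))" for s
  have "G 0 \<le> G d"
  proof (rule DERIV_nonneg_imp_nondecreasing[of 0 d G])
    fix s assume s: "0 \<le> s" "s \<le> d"
    have "(G has_real_derivative (\<Sum>i<n. \<Sum>j<n. w i * w j * f (a + s + t * 2 ^ (i + j)))) (at s)"
      unfolding G_def
    proof (intro DERIV_sum DERIV_cmult)
      fix i j
      have "(F has_real_derivative f (a + s + t * 2 ^ (i + j))) (at (s + (a + t * 2 ^ (i + j))))"
        using assms(2)[of "a + s + t * 2 ^ (i + j)"] at s by (simp add: add_pos_nonneg add_ac)
      then show "((\<lambda>s. F (a + s + t * 2 ^ (i + j))) has_real_derivative f (a + s + t * 2 ^ (i + j))) (at s)"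
        unfolding DERIV_shift by (simp add: add_ac)
    qed
    moreover have "0 \<le> (\<Sum>i<n. \<Sum>j<n. w i * w j * f (a + s + t * 2 ^ (i + j)))"
      using assms(1) at s by (simp add: hankel_nonneg_def)
    ultimately show "\<exists>y. (G has_real_derivative y) (at s) \<and> 0 \<le> y" by blast
  qed (use assms(3) in simp)
  moreover have "(\<Sum>i<n. \<Sum>j<n. w i * w j * fdiff d F (a + t * 2 ^ (i + j))) = G d - G 0"
    unfolding G_def fdiff_def sum_subtractf[symmetric] right_diff_distrib[symmetric]
    by (intro sum.cong refl) (simp add: add_ac)
  ultimately show "0 \<le> (\<Sum>i<n. \<Sum>j<n. w i * w j * fdiff d F (a + t * 2 ^ (i + j)))" by simp
qed

text \<open>Dependent choice with continuity as the invariant, which guarantees an antiderivative at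
  every stage.\<close>

lemma iterated_antiderivatives:
  fixes f :: "real \<Rightarrow> real"
  assumes "continuous_on {0<..} f"
  obtains G where "G 0 = f" "\<And>k x. x > 0 \<Longrightarrow> (G (Suc k) has_real_derivative G k x) (at x)"
proof -
  have "\<exists>G. \<forall>k. (continuous_on {0<..} (G k) \<and> (k = 0 \<longrightarrow> G k = f)) \<and>
    (\<forall>x>0. (G (Suc k) has_real_derivative G k x) (at x))"
  proof (rule dependent_nat_choice)
    fix g :: "real \<Rightarrow> real" and k :: nat
    assume "continuous_on {0<..} g \<and> (k = 0 \<longrightarrow> g = f)"
    then have "isCont g x" if "x > 0" for x
      using that by (simp add: continuous_on_eq_continuous_at)
    then obtain h where h: "\<And>x. x > 0 \<Longrightarrow> (h has_real_derivative g x) (at x)"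
      using einterval_antiderivative[of 0 \<infinity> g]
      by (auto simp: has_real_derivative_iff_has_vector_derivative)
    then have "continuous_on {0<..} h"
      by (auto intro!: continuous_at_imp_continuous_on DERIV_isCont)
    with h show "\<exists>h. (continuous_on {0<..} h \<and> (Suc k = 0 \<longrightarrow> h = f)) \<and>
        (\<forall>x>0. (h has_real_derivative g x) (at x))" by auto
  qed (use assms in auto)
  then show thesis using that by blast
qed

text \<open>Lets the Taylor argument apply to merely continuous \<open>f\<close>: each integration
  is paired with one difference, which preserves the form condition, and differentiating the result
  \<open>N\<close> times gives the \<open>N\<close>-th difference of \<open>f\<close>.\<close>

lemma hankel_nonneg_imp_fdiff_nonneg:
  assumes "hankel_nonneg (Suc N) f" "continuous_on {0<..} f" "d > 0" "x > 0"
  shows "0 \<le> (fdiff d ^^ N) f x"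
proof -
  obtain G where G: "G 0 = f" "\<And>k x. x > 0 \<Longrightarrow> (G (Suc k) has_real_derivative G k x) (at x)"
    using iterated_antiderivatives[OF assms(2)] by blast
  have "hankel_nonneg (Suc N) ((fdiff d ^^ k) (G k))" for k
  proof (induction k)
    case 0
    then show ?case using assms(1) G(1) by simp
  next
    case (Suc k)
    then have "hankel_nonneg (Suc N) (fdiff d ((fdiff d ^^ k) (G (Suc k))))"
      using has_real_derivative_funpow_fdiff[OF G(2) \<open>d > 0\<close>] \<open>d > 0\<close>
      by (rule hankel_nonneg_fdiff)
    then show ?case by simp
  qed
  \<comment> \<open>The index runs down from \<open>N\<close>, since differentiation lowers the
    order of the antiderivative.\<close>
  moreover have "((fdiff d ^^ N) (G (N - j)) has_real_derivative (fdiff d ^^ N) (G (N - Suc j)) x) (at x)"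
    if "j < N" "x > 0" for j x
    using has_real_derivative_funpow_fdiff[OF G(2)[of _ "N - Suc j"] \<open>d > 0\<close> \<open>x > 0\<close>] that
    by (simp add: Suc_diff_Suc)
  moreover have "continuous_on {0<..} ((fdiff d ^^ N) (G 0))"
    using assms(2,3) by (simp add: G(1) continuous_on_funpow_fdiff)
  ultimately have "0 \<le> (fdiff d ^^ N) (G (N - N)) x"
    using \<open>x > 0\<close> by (intro hankel_nonneg_imp_last_deriv_nonneg[of N "\<lambda>j. (fdiff d ^^ N) (G (N - j))"]) auto
  then show ?thesis using G(1) by simp
qed

lemma Ck_on_imp_DERIV:
  "Ck_on k f S \<Longrightarrow> j < k \<Longrightarrow> x \<in> S \<Longrightarrow>
    ((deriv ^^ j) f has_real_derivative (deriv ^^ Suc j) f x) (at x)"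
  by (simp add: Ck_on_def DERIV_deriv_iff_real_differentiable)

lemma Ck_on_le:
  assumes "Ck_on k f S" "j \<le> k"
  shows "Ck_on j f S"
proof (cases "j = k")
  case False
  then have "continuous_on S ((deriv ^^ j) f)"
    using assms Ck_on_imp_DERIV[OF assms(1)]
    by (intro continuous_at_imp_continuous_on) (metis DERIV_isCont le_neq_implies_less)
  then show ?thesis using assms by (auto simp: Ck_on_def)
qed (use assms in simp)

lemma hankel_nonneg_imp_deriv_nonneg:
  assumes "hankel_nonneg (Suc k) f" "Ck_on k f {0<..}" "x > 0"
  shows "0 \<le> (deriv ^^ k) f x"
  using assms Ck_on_imp_DERIV[OF assms(2)]
  by (intro hankel_nonneg_imp_last_deriv_nonneg[of k "\<lambda>j. (deriv ^^ j) f"]) (auto simp: Ck_on_def)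

theorem mainTheorem14:
  fixes f :: "real \<Rightarrow> real" and X0 :: "real set" and p :: nat
  assumes X0_interval: "is_interval X0"
    and X0_pos: "\<exists>a\<in>X0. \<exists>b\<in>X0. a < b"
    and p3: "p \<ge> 3"
    and hyp: "\<forall>u1 u2 c1 c2 :: real. u1 > 0 \<longrightarrow> u2 > 0 \<longrightarrow> c1 \<ge> 0 \<longrightarrow> c2 \<ge> 0 \<longrightarrow> c1 + c2 > 0 \<longrightarrow>
               TN p X0 (\<lambda>x y. f (c1 * u1 powr (x + y) + c2 * u2 powr (x + y)))"
  shows "Ck_on (p - 3) f {0<..}
     \<and> convex_on {0<..} ((deriv ^^ (p - 3)) f)
     \<and> (\<forall>k\<le>p - 3. \<forall>x>0. (deriv ^^ k) f x \<ge> 0)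
     \<and> (Ck_on (p - 1) f {0<..} \<longrightarrow>
          (\<forall>x>0. (deriv ^^ (p - 2)) f x \<ge> 0 \<and> (deriv ^^ (p - 1)) f x \<ge> 0))"
proof -
  note form = TN_imp_hankel_form_nonneg[OF X0_interval X0_pos hyp]
  \<comment> \<open>The form for \<open>n = 2\<close> with weights 1 and -1.\<close>
  have two: "2 * f (c1 * q1 + c2 * q2) \<le> f (c1 + c2) + f (c1 * q1\<^sup>2 + c2 * q2\<^sup>2)"
    if "q1 > 0" "q2 > 0" "c1 \<ge> 0" "c2 \<ge> 0" "c1 + c2 > 0" for q1 q2 c1 c2
    using form[of 2 q1 q2 c1 c2 "\<lambda>i. if i = 0 then 1 else -1"] that p3
    by (simp add: numeral_2_eq_2)
  have mono: "f x \<le> f y" if "0 < x" "x \<le> y" for x y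
  proof (cases "x = y")
    case False
    \<comment> \<open>Atoms \<open>1 / 2\<close> and \<open>1 + s\<close> with moments \<open>x, x, y\<close> of orders \<open>0, 1, 2\<close>.\<close>
    define s where "s = 2 * (y - x) / x"
    define c2 where "c2 = x / (1 + 2 * s)"
    have "s > 0" using that False by (simp add: s_def)
    then have "c2 > 0" "c2 * (1 + 2 * s) = x" using that by (simp_all add: c2_def)
    then have x: "x = c2 + 2 * s * c2" by (simp add: algebra_simps)
    have "s * x = 2 * (y - x)" using that by (simp add: s_def)
    then have y: "y = x + s * x / 2" by (simp add: field_simps)
    have atoms: "2 * s * c2 + c2 = x" "2 * s * c2 * (1 / 2) + c2 * (1 + s) = x"
      "2 * s * c2 * (1 / 2)\<^sup>2 + c2 * (1 + s)\<^sup>2 = y"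
      unfolding y x by (simp_all add: power2_eq_square field_simps)
    \<comment> \<open>Equality of the moments of orders 0 and 1 collapses the inequality to
      monotonicity.\<close>
    have "2 * f x \<le> f x + f y"
      using two[of "1 / 2" "1 + s" "2 * s * c2" c2] \<open>s > 0\<close> \<open>c2 > 0\<close>
      unfolding atoms using \<open>0 < x\<close> by simp
    then show ?thesis by simp
  qed simp
  have cont: "continuous_on {0<..} f"
  proof (rule mono_mult_midconvex_imp_continuous[OF mono])
    \<comment> \<open>A single atom \<open>q\<close> of weight \<open>x\<close> suffices
      here.\<close>
    show "2 * f (x * q) \<le> f x + f (x * q * q)" if "0 < x" "1 \<le> q" for x q
      using two[of q 1 x 0] that by (simp add: power2_eq_square mult_ac)
  qed
  have hankel: "hankel_nonneg n f" if "n \<le> p" for n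
    unfolding hankel_nonneg_def using form[OF that, of 1 2] by simp
  \<comment> \<open>Order \<open>j\<close> needs a form of size \<open>j + 1\<close>, so
    \<open>p - 1\<close> is the highest order available.\<close>
  have "0 \<le> (fdiff d ^^ j) f x" if "j \<le> p - 3 + 2" "d > 0" "x > 0" for j d x
    using that p3 by (intro hankel_nonneg_imp_fdiff_nonneg hankel cont) auto
  then have regular: "Ck_on (p - 3) f {0<..}" "convex_on {0<..} ((deriv ^^ (p - 3)) f)"
    using fdiff_nonneg_imp_regular[of "p - 3" f] by auto
  \<comment> \<open>Used with \<open>m = p - 3\<close> for the derivatives already obtained, and
    with \<open>m = p - 1\<close> under the extra smoothness assumption.\<close>
  have deriv_nonneg: "0 \<le> (deriv ^^ k) f x" if "Ck_on m f {0<..}" "k \<le> m" "k < p" "x > 0" for k m x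
    using that by (intro hankel_nonneg_imp_deriv_nonneg hankel Ck_on_le[OF that(1,2)]) auto
  show ?thesis
    using regular deriv_nonneg p3 by (auto intro: deriv_nonneg[OF regular(1)])
qed

end
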